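(* Let $G$ be an undirected graph with $N$ vertices, let $G^c$ be its complement graph, and let $M_G$ be the $(N+1)\times(N+1)$ matrix, with rows and columns indexed by $\{0,\dots,N\}$, whose entry $(M_G)_{i,j}$ is the number of permutations $\pi$ of $\{1,\dots,N\}$ such that $\sum_{s=1}^N (A_G)_{s,\pi(s)}=j$ and $\pi(s)=s$ for exactly $i$ elements $s$. Then for all $j=1,\ldots,N$: (a) the components of the mp-chart $H_G$ are $$h_G(j)=\sum_{i=0}^N (M_G)_{i,j};$$ (b) the components of the mp-chart $H_{G^c}$ are $$h_{G^c}(j)=\sum_{i=0}^{N-j} (M_G)_{i,N-j-i}.$$
   Context: Graphs are finite, undirected and without loops (and without multiple edges), with vertices labelled $1,\dots,N$. The adjacency matrix $A_G$ of $G=(V,E)$ is the symmetric $N\times N$ matrix with $(A_G)_{i,j}=1$ if $(i,j)\in E$ and $0$ otherwise; its diagonal entries are zero. The complement graph $G^c$ of $G=(V,E)$ is the graph on the same vertex set $V$ with edge set $(V^2\setminus\Delta)\setminus E$, where $\Delta=\{(v,v): v\in V\}$ (so $G^c$ also has no loops). For $0\le k\le N$, $h_G(k)$ is the number of permutations $\pi$ of $\{1,\dots,N\}$ such that $\sum_{i=1}^N (A_G)_{i,\pi(i)}=k$. The mp-chart of $G$ is the vector $H_G=(h_G(0),\dots,h_G(N))$. *)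

theory Defs
  imports
    "Graph_Theory.Pair_Digraph"
    "Jordan_Normal_Form.Matrix"
    "HOL-Combinatorics.Permutations"
begin

text \<open>
  An undirected loop-free graph is represented by a symmetric irreflexive set of ordered pairs
  (locale \<open>pair_graph\<close>), so \<open>parcs G\<close> is a subset of \<open>V\<^sup>2\<close>
  and contains both orientations of every edge.
  The definitions below are meant for graphs with vertex set \<open>{1..num_verts G}\<close>.
\<close>

abbreviation num_verts :: "nat pair_pre_digraph \<Rightarrow> nat" where
  "num_verts G \<equiv> card (pverts G)"

text \<open>
  Matrices of \<open>Jordan_Normal_Form\<close> are indexed from 0, vertices from 1: the entry for the
  vertices \<open>i\<close> and \<open>j\<close> sits at position \<open>(i - 1, j - 1)\<close>.
\<close>

definition adj_matrix :: "nat pair_pre_digraph \<Rightarrow> nat mat" where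
  "adj_matrix G =
     mat (num_verts G) (num_verts G) (\<lambda>(r, c). if (r + 1, c + 1) \<in> parcs G then 1 else 0)"

lemma adj_matrix_entry:
  assumes "i \<in> {1..num_verts G}" and "j \<in> {1..num_verts G}"
  shows "adj_matrix G $$ (i - 1, j - 1) = (if (i, j) \<in> parcs G then 1 else 0)"
  using assms by (cases i; cases j) (auto simp: adj_matrix_def)

definition complement_graph :: "nat pair_pre_digraph \<Rightarrow> nat pair_pre_digraph" where
  "complement_graph G =
     \<lparr> pverts = pverts G,
       parcs = ((pverts G \<times> pverts G) - {(v, v) | v. v \<in> pverts G}) - parcs G \<rparr>"

definition perm_weight :: "nat pair_pre_digraph \<Rightarrow> (nat \<Rightarrow> nat) \<Rightarrow> nat" where
  "perm_weight G \<pi> = (\<Sum>s = 1..num_verts G. adj_matrix G $$ (s - 1, \<pi> s - 1))"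

definition h_count :: "nat pair_pre_digraph \<Rightarrow> nat \<Rightarrow> nat" where
  "h_count G k = card {\<pi>. \<pi> permutes {1..num_verts G} \<and> perm_weight G \<pi> = k}"

definition mp_chart :: "nat pair_pre_digraph \<Rightarrow> nat vec" where
  "mp_chart G = vec (num_verts G + 1) (h_count G)"

definition M_matrix :: "nat pair_pre_digraph \<Rightarrow> nat mat" where
  "M_matrix G =
     mat (num_verts G + 1) (num_verts G + 1)
       (\<lambda>(i, j). card {\<pi>. \<pi> permutes {1..num_verts G} \<and> perm_weight G \<pi> = j \<and>
                          card {s \<in> {1..num_verts G}. \<pi> s = s} = i})"

lemma pair_graph_complement_graph:
  assumes "pair_graph G"
  shows "pair_graph (complement_graph G)"
proof -
  interpret pair_graph G by fact
  have "(v, u) \<in> parcs G" if "(u, v) \<in> parcs G" for u v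
    using that arcs_symmetric by blast
  then show ?thesis
    by unfold_locales
      (auto simp: complement_graph_def symmetric_def sym_def arcs_ends_def arc_to_ends_def)
qed

end

theory Submission
  imports Defs
begin

text \<open>
  A permutation \<open>\<pi>\<close> sorts the vertices \<open>s\<close> into three disjoint kinds: \<open>(s, \<pi> s)\<close> is an arc
  of \<open>G\<close>, \<open>(s, \<pi> s)\<close> is an arc of the complement, or \<open>\<pi> s = s\<close>. Since the diagonal belongs to
  neither graph, the weights of \<open>\<pi>\<close> for \<open>G\<close> and for its complement and the number of
  fixed points of \<open>\<pi>\<close> add up to the number of vertices (\<open>perm_weight_complement\<close>).
  Both formulas then result from sorting permutations by their number \<open>i\<close> of fixed points:
  those of \<open>G\<close>-weight \<open>j\<close> form a column of \<open>M_matrix G\<close>, and those of complement weight \<open>j\<close>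
  have \<open>G\<close>-weight \<open>N - j - i\<close>, so they lie on an antidiagonal of \<open>M_matrix G\<close>.
\<close>

lemma perm_weight_eq_card:
  assumes "pverts G = {1..N}" and "\<pi> permutes {1..N}"
  shows "perm_weight G \<pi> = card {s \<in> {1..N}. (s, \<pi> s) \<in> parcs G}"
proof -
  have "perm_weight G \<pi> = (\<Sum>s = 1..N. if (s, \<pi> s) \<in> parcs G then 1 else 0)"
    unfolding perm_weight_def
  proof (rule sum.cong)
    fix s assume "s \<in> {1..N}"
    moreover from this have "\<pi> s \<in> {1..N}"
      using assms(2) by (simp only: permutes_in_image)
    ultimately show "adj_matrix G $$ (s - 1, \<pi> s - 1) = (if (s, \<pi> s) \<in> parcs G then 1 else 0)"
      using assms(1) by (intro adj_matrix_entry) simp_all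
  qed (use assms(1) in simp)
  also have "\<dots> = card {s \<in> {1..N}. (s, \<pi> s) \<in> parcs G}"
    by (simp add: sum.If_cases Int_def)
  finally show ?thesis .
qed

text \<open>
  Each non-fixed \<open>s\<close> gives an off-diagonal pair \<open>(s, \<pi> s)\<close>, which is an arc of exactly one of
  the two graphs; a fixed point gives a loop, which is an arc of neither.
\<close>
lemma perm_weight_complement:
  assumes "pair_graph G" and verts: "pverts G = {1..N}" and perm: "\<pi> permutes {1..N}"
  shows "card {s \<in> {1..N}. \<pi> s = s} + perm_weight G \<pi> + perm_weight (complement_graph G) \<pi> = N"
proof -
  interpret pair_graph G by fact
  let ?F = "{s \<in> {1..N}. \<pi> s = s}"
  let ?A = "{s \<in> {1..N}. (s, \<pi> s) \<in> parcs G}"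
  let ?B = "{s \<in> {1..N}. (s, \<pi> s) \<in> parcs (complement_graph G)}"
  have loopfree: "(s, s) \<notin> parcs G" for s
    using no_loops by fastforce
  have image: "\<pi> s \<in> {1..N}" if "s \<in> {1..N}" for s
    using that perm by (simp only: permutes_in_image)
  have arc_iff: "(s, \<pi> s) \<in> parcs (complement_graph G) \<longleftrightarrow> \<pi> s \<noteq> s \<and> (s, \<pi> s) \<notin> parcs G"
    if "s \<in> {1..N}" for s
    using image[OF that] that verts by (auto simp: complement_graph_def)
  have "card {1..N} = card (?F \<union> ?A \<union> ?B)"
    using arc_iff by (intro arg_cong[where f = card]) blast
  also have "\<dots> = card (?F \<union> ?A) + card ?B"
    using arc_iff by (intro card_Un_disjoint) auto
  also have "card (?F \<union> ?A) = card ?F + card ?A"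
    using loopfree by (intro card_Un_disjoint) auto
  finally show ?thesis
    using perm_weight_eq_card[OF verts perm] perm_weight_eq_card[of "complement_graph G" N \<pi>]
      verts perm by (simp add: complement_graph_def)
qed

lemma card_eq_sum_card_fibres:
  assumes "finite A" and "finite I" and "f ` A \<subseteq> I"
  shows "card A = (\<Sum>i \<in> I. card {x \<in> A. f x = i})"
  using sum.group[OF assms, of "\<lambda>_. 1 :: nat"] by simp

theorem proposition4p9:
  fixes G :: "nat pair_pre_digraph" and N :: nat
  assumes "pair_graph G" and "pverts G = {1..N}"
  shows "\<forall>j \<in> {1..N}.
           mp_chart G $ j = (\<Sum>i = 0..N. M_matrix G $$ (i, j)) \<and>
           mp_chart (complement_graph G) $ j = (\<Sum>i = 0..N - j. M_matrix G $$ (i, N - j - i))"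
proof (intro ballI conjI)
  fix j assume j: "j \<in> {1..N}"
  let ?w = "perm_weight G" and ?wc = "perm_weight (complement_graph G)"
  let ?fix = "\<lambda>\<pi>. card {s \<in> {1..N}. \<pi> s = s}"
  have total: "?fix \<pi> + ?w \<pi> + ?wc \<pi> = N" if "\<pi> permutes {1..N}" for \<pi>
    using assms that by (rule perm_weight_complement)
  have fin: "finite {\<pi>. \<pi> permutes {1..N} \<and> P \<pi>}" for P
    by (rule finite_subset[OF _ finite_permutations[of "{1..N}"]]) auto
  have M: "M_matrix G $$ (i, k) = card {\<pi>. \<pi> permutes {1..N} \<and> ?w \<pi> = k \<and> ?fix \<pi> = i}"
    if "i \<le> N" "k \<le> N" for i k
    using that assms(2) by (simp add: M_matrix_def)
  show "mp_chart G $ j = (\<Sum>i = 0..N. M_matrix G $$ (i, j))"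
  proof -
    let ?A = "{\<pi>. \<pi> permutes {1..N} \<and> ?w \<pi> = j}"
    have "mp_chart G $ j = card ?A"
      using j assms(2) by (simp add: mp_chart_def h_count_def)
    also have "\<dots> = (\<Sum>i = 0..N. card {\<pi> \<in> ?A. ?fix \<pi> = i})"
      using total by (intro card_eq_sum_card_fibres fin) fastforce+
    also have "\<dots> = (\<Sum>i = 0..N. M_matrix G $$ (i, j))"
      using j by (intro sum.cong) (simp_all add: M conj_assoc)
    finally show ?thesis .
  qed
  show "mp_chart (complement_graph G) $ j = (\<Sum>i = 0..N - j. M_matrix G $$ (i, N - j - i))"
  proof -
    let ?A = "{\<pi>. \<pi> permutes {1..N} \<and> ?wc \<pi> = j}"
    have "mp_chart (complement_graph G) $ j = card ?A"
      using j assms(2) by (simp add: mp_chart_def h_count_def complement_graph_def)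
    also have "\<dots> = (\<Sum>i = 0..N - j. card {\<pi> \<in> ?A. ?fix \<pi> = i})"
      using total by (intro card_eq_sum_card_fibres fin) fastforce+
    also have "\<dots> = (\<Sum>i = 0..N - j. M_matrix G $$ (i, N - j - i))"
    proof (rule sum.cong)
      fix i assume i: "i \<in> {0..N - j}"
      have "?wc \<pi> = j \<and> ?fix \<pi> = i \<longleftrightarrow> ?w \<pi> = N - j - i \<and> ?fix \<pi> = i"
        if "\<pi> permutes {1..N}" for \<pi>
        \<comment> \<open>The bounds on \<open>i\<close> and \<open>j\<close> ensure that the subtraction does not truncate.\<close>
        using total[OF that] i j by auto
      then have "{\<pi> \<in> ?A. ?fix \<pi> = i}
          = {\<pi>. \<pi> permutes {1..N} \<and> ?w \<pi> = N - j - i \<and> ?fix \<pi> = i}"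
        by blast
      then show "card {\<pi> \<in> ?A. ?fix \<pi> = i} = M_matrix G $$ (i, N - j - i)"
        using i by (subst M) auto
    qed simp
    finally show ?thesis .
  qed
qed

end
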